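(* All transitive degenerations among $\mathcal{N}_3(\mathbb{C})$ are captured by the Hasse diagram $$\mu_{3,4}\rightarrow\mu_{3,3}\rightarrow\mu_{3,2}\rightarrow\mu_{3,1};$$ that is, each displayed arrow is a degeneration, and for distinct $i,j\in\{1,2,3,4\}$ one has $\mu_{3,i}\rightsquigarrow\mu_{3,j}$ if and only if $i>j$. Moreover, $\mu_{3,2}$ is also a degeneration of $\mu_{3,4}$.
   Context: An evolution algebra over $\mathbb{C}$ is a finite-dimensional complex vector space $V$ with a bilinear product $\mu$ admitting a basis $\{e_1,\dots,e_n\}$ (natural basis) with $\mu(e_i,e_j)=0$ for $i\ne j$; it is denoted by its product $\mu$, and $e_i^2=\mu(e_i,e_i)$. $\mathcal{N}_3(\mathbb{C})$ denotes the three-dimensional nilpotent evolution algebras over $\mathbb{C}$, which up to isomorphism are exactly: - $\mu_{3,1}$: $e_1^2=e_2^2=e_3^2=0$; - $\mu_{3,2}$: $e_1^2=e_2,\ e_2^2=e_3^2=0$; - $\mu_{3,3}$: $e_1^2=e_2^2=e_3,\ e_3^2=0$; - $\mu_{3,4}$: $e_1^2=e_2,\ e_2^2=e_3,\ e_3^2=0$. Degeneration: for $g\in\operatorname{GL}(n,\mathbb{C})$, $(g\cdot\mu)(x,y)=g(\mu(g^{-1}x,g^{-1}y))$. The matrix $g$ defines a natural basis change of $\mu$ if it represents a change from the given natural basis to another natural basis; i.e., in coordinates, with $f_1,\dots,f_n$ denoting the basis vectors for the transformed product, $(g\cdot\mu)(f_i,f_j)=0$ for all $i\ne j$. $\lambda$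 is a (formal evolution) degeneration of $\mu$, written $\mu\rightarrow\lambda$, if there is a continuous map $g\colon(0,1]\to\operatorname{GL}(n,\mathbb{C})$, $t\mapsto g_t$, with each $g_t$ defining a natural basis change of $\mu$, such that $\lambda=\lim_{t\to0}g_t\cdot\mu$ (convergence of structure constants). For a family $\mathcal{F}$ of evolution algebras and $\mu,\lambda\in\mathcal{F}$, $\lambda$ is a transitive degeneration of $\mu$ among $\mathcal{F}$, written $\mu\rightsquigarrow\lambda$, if there is a finite sequence of degenerations $\mu=\mu_0\rightarrow\mu_1\rightarrow\cdots\rightarrow\mu_k=\lambda$ with all $\mu_i\in\mathcal{F}$. Here $\mathcal{F}=\mathcal{N}_3(\mathbb{C})$. *)

theory Defs
  imports "HOL-Analysis.Analysis"
begin

text \<open>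
  An algebra structure on the complex vector space \<^typ>\<open>complex^'n\<close> is given by its product.
  Linear notions are taken over the complex scalars, i.e. with respect to the scaling \<open>(*s)\<close>
  (and \<open>vec.span\<close>, \<open>vec.independent\<close>), not with respect to the real structure.
\<close>

type_synonym 'n product = "complex^'n \<Rightarrow> complex^'n \<Rightarrow> complex^'n"

definition complex_bilinear :: "'n::finite product \<Rightarrow> bool" where
  "complex_bilinear \<mu> \<longleftrightarrow>
     (\<forall>x. Vector_Spaces.linear (*s) (*s) (\<lambda>y. \<mu> x y)) \<and>
     (\<forall>y. Vector_Spaces.linear (*s) (*s) (\<lambda>x. \<mu> x y))"

definition natural_basis :: "'n::finite product \<Rightarrow> ('n \<Rightarrow> complex^'n) \<Rightarrow> bool" where
  "natural_basis \<mu> b \<longleftrightarrow>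
     inj b \<and> vec.independent (range b) \<and> vec.span (range b) = UNIV \<and>
     (\<forall>i j. i \<noteq> j \<longrightarrow> \<mu> (b i) (b j) = 0)"

definition evolution_algebra :: "'n::finite product \<Rightarrow> bool" where
  "evolution_algebra \<mu> \<longleftrightarrow> complex_bilinear \<mu> \<and> (\<exists>b. natural_basis \<mu> b)"

text \<open>
  Powers of a nonassociative algebra \<open>A\<close>: \<open>A\<^sup>1 = A\<close> and
  \<open>A\<^sup>k = A\<^sup>1 A\<^sup>k\<^sup>-\<^sup>1 + A\<^sup>2 A\<^sup>k\<^sup>-\<^sup>2 + \<dots> + A\<^sup>k\<^sup>-\<^sup>1 A\<^sup>1\<close> (with the harmless convention \<open>A\<^sup>0 = A\<close>).
\<close>

fun algebra_power :: "'n::finite product \<Rightarrow> nat \<Rightarrow> (complex^'n) set" where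
  "algebra_power \<mu> k =
     (if k \<le> 1 then UNIV
      else vec.span (\<Union>i\<in>{1..<k}.
             {\<mu> x y | x y. x \<in> algebra_power \<mu> i \<and> y \<in> algebra_power \<mu> (k - i)}))"

declare algebra_power.simps [simp del]

definition nilpotent_algebra :: "'n::finite product \<Rightarrow> bool" where
  "nilpotent_algebra \<mu> \<longleftrightarrow> (\<exists>k. algebra_power \<mu> k = {0})"

definition nilpotent_evolution_algebras_3 :: "3 product set" where
  "nilpotent_evolution_algebras_3 = {\<mu>. evolution_algebra \<mu> \<and> nilpotent_algebra \<mu>}"

definition gl_action :: "complex^'n^'n \<Rightarrow> 'n::finite product \<Rightarrow> 'n product" where
  "gl_action g \<mu> x y = g *v \<mu> (matrix_inv g *v x) (matrix_inv g *v y)"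

text \<open>
  The basis vectors for the transformed product are the coordinate vectors
  \<open>axis i 1\<close>; they correspond to the vectors \<open>g\<^sup>-\<^sup>1 (axis i 1)\<close> of the original algebra.
\<close>

definition natural_basis_change :: "complex^'n^'n \<Rightarrow> 'n::finite product \<Rightarrow> bool" where
  "natural_basis_change g \<mu> \<longleftrightarrow>
     invertible g \<and> (\<forall>i j. i \<noteq> j \<longrightarrow> gl_action g \<mu> (axis i 1) (axis j 1) = 0)"

definition structure_constant :: "'n::finite product \<Rightarrow> 'n \<Rightarrow> 'n \<Rightarrow> 'n \<Rightarrow> complex" where
  "structure_constant \<mu> i j k = \<mu> (axis i 1) (axis j 1) $ k"

definition degeneration :: "'n::finite product \<Rightarrow> 'n product \<Rightarrow> bool" where
  "degeneration \<mu> \<nu> \<longleftrightarrow>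
     evolution_algebra \<mu> \<and> evolution_algebra \<nu> \<and>
     (\<exists>g :: real \<Rightarrow> complex^'n^'n.
        continuous_on {0<..1} g \<and>
        (\<forall>t\<in>{0<..1}. natural_basis_change (g t) \<mu>) \<and>
        (\<forall>i j k. ((\<lambda>t. structure_constant (gl_action (g t) \<mu>) i j k)
                    \<longlongrightarrow> structure_constant \<nu> i j k) (at 0 within {0<..1})))"

definition transitive_degeneration ::
    "'n::finite product set \<Rightarrow> 'n product \<Rightarrow> 'n product \<Rightarrow> bool" where
  "transitive_degeneration F \<mu> \<nu> \<longleftrightarrow>
     (\<exists>(k::nat) c. c 0 = \<mu> \<and> c k = \<nu> \<and> (\<forall>i\<le>k. c i \<in> F) \<and>
        (\<forall>i<k. degeneration (c i) (c (Suc i))))"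

text \<open>The evolution algebra whose standard basis is natural, with \<open>e\<^sub>i\<^sup>2\<close> the \<open>i\<close>-th row of \<open>M\<close>.\<close>

definition evolution_product :: "complex^'n^'n \<Rightarrow> 'n::finite product" where
  "evolution_product M x y = (\<Sum>i\<in>UNIV. (x $ i * y $ i) *s (M $ i))"

text \<open>
  \<open>mu3 m\<close> is the algebra \<open>\<mu>\<^sub>3\<^sub>,\<^sub>m\<close>, meaningful for \<open>m \<in> {1..4}\<close> only. The lists give
  \<open>e\<^sub>1\<^sup>2\<close>, \<open>e\<^sub>2\<^sup>2\<close>, \<open>e\<^sub>3\<^sup>2\<close>; indices live in the three-element type \<open>3\<close>, where the numeral
  \<open>3\<close> denotes the same element as \<open>0\<close> and is distinct from \<open>1\<close> and \<open>2\<close>.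
\<close>

definition mu3 :: "nat \<Rightarrow> 3 product" where
  "mu3 m = evolution_product (vector
     (if m = 1 then [0, 0, 0]
      else if m = 2 then [axis 2 1, 0, 0]
      else if m = 3 then [axis 3 1, axis 3 1, 0]
      else if m = 4 then [axis 2 1, axis 3 1, 0]
      else undefined))"

end

theory Submission
  imports Defs
begin

text \<open>
  Each arrow comes from an explicit curve of natural bases. Conversely, polynomial identities that
  do not depend on a choice of basis are inherited by degenerations, and three of them separate
  the algebras: \<open>xy = 0\<close> holds only in \<open>\<mu>\<^sub>3\<^sub>,\<^sub>1\<close>; the identity \<open>xy \<otimes> zw = xz \<otimes> yw\<close> holds in
  \<open>\<mu>\<^sub>3\<^sub>,\<^sub>2\<close>, where the product is \<open>\<phi>(x)\<phi>(y)e\<^sub>2\<close> for a linear form \<open>\<phi>\<close>, but not in \<open>\<mu>\<^sub>3\<^sub>,\<^sub>3\<close> or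
  \<open>\<mu>\<^sub>3\<^sub>,\<^sub>4\<close>; and \<open>(xy)z = 0\<close> fails only in \<open>\<mu>\<^sub>3\<^sub>,\<^sub>4\<close>.
\<close>

section \<open>Bilinear products in coordinates and the action of invertible matrices\<close>

lemma complex_bilinear_expand:
  fixes \<mu> :: "'n::finite product"
  assumes "complex_bilinear \<mu>"
  shows "\<mu> x y $ k = (\<Sum>i\<in>UNIV. \<Sum>j\<in>UNIV. x $ i * y $ j * structure_constant \<mu> i j k)"
proof -
  interpret A: Vector_Spaces.linear "(*s)" "(*s)" "\<lambda>y. \<mu> a y" for a
    using assms by (simp add: complex_bilinear_def)
  interpret B: Vector_Spaces.linear "(*s)" "(*s)" "\<lambda>x. \<mu> x b" for b
    using assms by (simp add: complex_bilinear_def)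
  have "\<mu> x y = \<mu> (\<Sum>i\<in>UNIV. x $ i *s axis i 1) (\<Sum>j\<in>UNIV. y $ j *s axis j 1)"
    by (simp add: basis_expansion)
  also have "\<dots> = (\<Sum>i\<in>UNIV. x $ i *s \<mu> (axis i 1) (\<Sum>j\<in>UNIV. y $ j *s axis j 1))"
    by (simp only: B.sum B.scale)
  also have "\<dots> = (\<Sum>i\<in>UNIV. x $ i *s (\<Sum>j\<in>UNIV. y $ j *s \<mu> (axis i 1) (axis j 1)))"
    by (simp only: A.sum A.scale)
  finally show ?thesis
    by (simp add: structure_constant_def sum_distrib_left mult.assoc)
qed

lemma complex_bilinear_gl_action:
  fixes \<mu> :: "'n::finite product"
  assumes "complex_bilinear \<mu>"
  shows "complex_bilinear (gl_action g \<mu>)"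
proof -
  have "Vector_Spaces.linear (*s) (*s) (\<lambda>y. \<mu> x y)" "Vector_Spaces.linear (*s) (*s) (\<lambda>x. \<mu> x y)"
    for x y using assms by (simp_all add: complex_bilinear_def)
  then show ?thesis
    unfolding complex_bilinear_def Vector_Spaces.linear_iff gl_action_def
    by (simp add: matrix_vector_right_distrib vec.scale vec.add)
qed

lemma matrix_inv_left:
  assumes "invertible A"
  shows "matrix_inv A ** A = mat 1"
  using assms unfolding invertible_def matrix_inv_def by (rule conjunct2[OF someI_ex])

lemma matrix_inv_unique:
  fixes A :: "'a::semiring_1^'n^'m"
  assumes "A ** B = mat 1" "B ** A = mat 1"
  shows "matrix_inv A = B"
proof -
  have "invertible A"
    using assms by (auto simp: invertible_def)
  then show ?thesis
    by (metis assms(1) matrix_inv_left matrix_mul_assoc matrix_mul_lid matrix_mul_rid)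
qed

section \<open>Limits of products along a degeneration\<close>

text \<open>The arguments may move with \<open>t\<close>, so that nested products, whose inner
  factor depends on \<open>t\<close>, also converge.\<close>

definition products_tendsto :: "(real \<Rightarrow> 'n::finite product) \<Rightarrow> 'n product \<Rightarrow> bool" where
  "products_tendsto m \<nu> \<longleftrightarrow> (\<forall>X Y x y.
     (X \<longlongrightarrow> x) (at 0 within {0<..1}) \<longrightarrow> (Y \<longlongrightarrow> y) (at 0 within {0<..1}) \<longrightarrow>
     ((\<lambda>t. m t (X t) (Y t)) \<longlongrightarrow> \<nu> x y) (at 0 within {0<..1}))"

lemma products_tendstoD:
  assumes "products_tendsto m \<nu>"
    and "(X \<longlongrightarrow> x) (at 0 within {0<..1})" "(Y \<longlongrightarrow> y) (at 0 within {0<..1})"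
  shows "((\<lambda>t. m t (X t) (Y t)) \<longlongrightarrow> \<nu> x y) (at 0 within {0<..1})"
  using assms by (simp add: products_tendsto_def)

text \<open>Each coordinate of a bilinear product is a polynomial in the structure constants and the
  coordinates of the arguments, so convergence of the structure constants passes to all
  products.\<close>

lemma degeneration_products_tendsto:
  fixes \<mu> \<nu> :: "'n::finite product"
  assumes "degeneration \<mu> \<nu>"
  obtains g where "\<And>t. t \<in> {0<..1} \<Longrightarrow> invertible (g t)"
    "products_tendsto (\<lambda>t. gl_action (g t) \<mu>) \<nu>"
proof -
  obtain g :: "real \<Rightarrow> complex^'n^'n" where
    g: "\<forall>t\<in>{0<..1}. natural_basis_change (g t) \<mu>" and
    lim: "\<And>i j k. ((\<lambda>t. structure_constant (gl_action (g t) \<mu>) i j k)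
            \<longlongrightarrow> structure_constant \<nu> i j k) (at 0 within {0<..1})"
    using assms by (auto simp: degeneration_def)
  have bil: "complex_bilinear \<mu>" "complex_bilinear \<nu>"
    using assms by (auto simp: degeneration_def evolution_algebra_def)
  show ?thesis
  proof
    show "invertible (g t)" if "t \<in> {0<..1}" for t
      using g that by (auto simp: natural_basis_change_def)
    show "products_tendsto (\<lambda>t. gl_action (g t) \<mu>) \<nu>"
      unfolding products_tendsto_def
      by (intro allI impI vec_tendstoI)
        (simp only: complex_bilinear_expand[OF complex_bilinear_gl_action[OF bil(1)]]
          complex_bilinear_expand[OF bil(2)], intro tendsto_intros lim)
  qed
qed

lemma at_0_within_Ioc_nontrivial: "at (0::real) within {0<..1} \<noteq> bot"
  by (simp add: trivial_limit_within islimpt_Ioc)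

text \<open>This carries an identity valid for every \<open>t\<close> in the half-open interval over
  to the limit: 0 is a limit point of that interval, so limits there are unique.\<close>

lemma tendsto_0_within_Ioc_eq:
  fixes f f' :: "real \<Rightarrow> 'a::t2_space"
  assumes "(f \<longlongrightarrow> a) (at 0 within {0<..1})" "(f' \<longlongrightarrow> b) (at 0 within {0<..1})"
    and "\<And>t. t \<in> {0<..1} \<Longrightarrow> f t = f' t"
  shows "a = b"
proof -
  have "\<forall>\<^sub>F t in at 0 within {0<..1}. f' t = f t"
    using assms(3) by (simp add: eventually_at_filter)
  then have "(f \<longlongrightarrow> b) (at 0 within {0<..1})"
    using assms(2) tendsto_cong by fast
  then show ?thesis
    using tendsto_unique[OF at_0_within_Ioc_nontrivial assms(1)] by blast
qed

section \<open>Identities inherited by degenerations\<close>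

lemma degeneration_zero_product:
  assumes "degeneration \<mu> \<nu>" and "\<And>x y. \<mu> x y = 0"
  shows "\<nu> x y = 0"
proof -
  obtain g where "products_tendsto (\<lambda>t. gl_action (g t) \<mu>) \<nu>"
    using degeneration_products_tendsto[OF assms(1)] by blast
  note g = products_tendstoD[OF this]
  show ?thesis
    by (rule tendsto_0_within_Ioc_eq[OF g[OF tendsto_const tendsto_const] tendsto_const])
      (simp add: gl_action_def assms(2))
qed

text \<open>The indices \<open>k\<close> and \<open>l\<close> run over the coordinates of the two
  tensor factors, so the tensor identity needs no tensor product type.\<close>

definition rank_one_product :: "'n::finite product \<Rightarrow> bool" where
  "rank_one_product \<mu> \<longleftrightarrow>
     (\<forall>x y z w k l. \<mu> x y $ k * \<mu> z w $ l = \<mu> x z $ k * \<mu> y w $ l)"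

text \<open>On the tensor of two products \<open>g\<close> acts as \<open>g\<close> tensor
  \<open>g\<close>. Both sides of the identity thus become linear combinations of old coordinates
  with the same coefficients.\<close>

lemma rank_one_product_gl_action:
  assumes "rank_one_product \<mu>"
  shows "rank_one_product (gl_action g \<mu>)"
proof -
  have *: "\<mu> x y $ k * \<mu> z w $ l = \<mu> x z $ k * \<mu> y w $ l" for x y z w k l
    using assms by (simp add: rank_one_product_def)
  have expand: "(g *v \<mu> x y) $ k * (g *v \<mu> z w) $ l
      = (\<Sum>p\<in>UNIV. \<Sum>q\<in>UNIV. g $ k $ p * g $ l $ q * (\<mu> x y $ p * \<mu> z w $ q))" for x y z w k l
    by (auto simp: matrix_vector_mult_def sum_product intro!: sum.cong)
  show ?thesis
    unfolding rank_one_product_def gl_action_def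
  proof (intro allI)
    fix x y z w k l
    let ?i = "matrix_inv g"
    show "(g *v \<mu> (?i *v x) (?i *v y)) $ k * (g *v \<mu> (?i *v z) (?i *v w)) $ l
        = (g *v \<mu> (?i *v x) (?i *v z)) $ k * (g *v \<mu> (?i *v y) (?i *v w)) $ l"
      by (simp only: expand *[of "?i *v x" "?i *v y" _ "?i *v z" "?i *v w"])
  qed
qed

lemma degeneration_rank_one_product:
  assumes "degeneration \<mu> \<nu>" and "rank_one_product \<mu>"
  shows "rank_one_product \<nu>"
  unfolding rank_one_product_def
proof (intro allI)
  fix x y z w k l
  obtain g where "products_tendsto (\<lambda>t. gl_action (g t) \<mu>) \<nu>"
    using degeneration_products_tendsto[OF assms(1)] by blast
  note g = products_tendstoD[OF this]
  have lim: "((\<lambda>t. gl_action (g t) \<mu> x y $ k * gl_action (g t) \<mu> z w $ l)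
      \<longlongrightarrow> \<nu> x y $ k * \<nu> z w $ l) (at 0 within {0<..1})" for x y z w
    by (rule tendsto_mult[OF tendsto_vec_nth tendsto_vec_nth])
      (rule g[OF tendsto_const tendsto_const])+
  show "\<nu> x y $ k * \<nu> z w $ l = \<nu> x z $ k * \<nu> y w $ l"
    by (rule tendsto_0_within_Ioc_eq[OF lim lim])
      (use rank_one_product_gl_action[OF assms(2)] in \<open>unfold rank_one_product_def, blast\<close>)
qed

definition two_step_product :: "'n::finite product \<Rightarrow> bool" where
  "two_step_product \<mu> \<longleftrightarrow> (\<forall>x y z. \<mu> (\<mu> x y) z = 0)"

lemma degeneration_two_step_product:
  assumes "degeneration \<mu> \<nu>" and "two_step_product \<mu>"
  shows "two_step_product \<nu>"
  unfolding two_step_product_def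
proof (intro allI)
  fix x y z
  obtain g where inv: "\<And>t. t \<in> {0<..1} \<Longrightarrow> invertible (g t)"
    and "products_tendsto (\<lambda>t. gl_action (g t) \<mu>) \<nu>"
    using degeneration_products_tendsto[OF assms(1)] by blast
  note g = products_tendstoD[OF this(2)]
  show "\<nu> (\<nu> x y) z = 0"
  \<comment> \<open>The inner use of \<open>g\<close> gives the convergent first argument of the
    outer one. For fixed \<open>t\<close>, the inverse in the outer product cancels the matrix in
    front of the inner one.\<close>
  proof (rule tendsto_0_within_Ioc_eq[OF g[OF g[OF tendsto_const tendsto_const] tendsto_const]
        tendsto_const])
    fix t :: real
    assume "t \<in> {0<..1}"
    then show "gl_action (g t) \<mu> (gl_action (g t) \<mu> x y) z = 0"
      using assms(2)
      by (simp add: gl_action_def matrix_vector_mul_assoc matrix_inv_left inv two_step_product_def)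
  qed
qed

text \<open>With \<open>P\<close> an inherited identity, this makes the failure of \<open>P\<close>
  at the end of a chain an obstruction to the chain.\<close>

lemma transitive_degeneration_induct:
  assumes "transitive_degeneration F \<mu> \<nu>" and "P \<mu>"
    and step: "\<And>\<mu> \<nu>. degeneration \<mu> \<nu> \<Longrightarrow> P \<mu> \<Longrightarrow> P \<nu>"
  shows "P \<nu>"
proof -
  obtain k c where c: "c 0 = \<mu>" "c k = \<nu>" "\<And>i. i < k \<Longrightarrow> degeneration (c i) (c (Suc i))"
    using assms(1) by (auto simp: transitive_degeneration_def)
  have "i \<le> k \<Longrightarrow> P (c i)" for i
    by (induction i) (use c(1,3) step assms(2) in \<open>auto simp: Suc_le_eq\<close>)
  then show ?thesis
    using c(2) by blast
qed

lemma transitive_degenerationI: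
  assumes "\<And>m. m \<le> k \<Longrightarrow> c m \<in> F" "\<And>m. m < k \<Longrightarrow> degeneration (c m) (c (Suc m))"
  shows "transitive_degeneration F (c 0) (c k)"
  unfolding transitive_degeneration_def using assms by blast

section \<open>Evolution products and degenerations from curves of natural bases\<close>

lemma complex_bilinear_evolution_product: "complex_bilinear (evolution_product M)"
  unfolding complex_bilinear_def Vector_Spaces.linear_iff evolution_product_def
  by (simp add: vec.vector_space_axioms vec.scale_sum_right algebra_simps sum.distrib)

lemma evolution_product_axis:
  "evolution_product M (axis i 1) (axis j 1) = (if i = j then M $ i else 0)"
proof -
  have "(axis i 1 $ k * axis j 1 $ k) *s M $ k = (if k = i then if i = j then M $ i else 0 else 0)"
    for k by (simp add: axis_def)
  then show ?thesis
    by (simp add: evolution_product_def)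
qed

lemma evolution_algebra_evolution_product: "evolution_algebra (evolution_product M)"
proof -
  have eq: "range (\<lambda>i. axis i 1) = (cart_basis :: (complex^'n) set)"
    by (auto simp: cart_basis_def)
  have "natural_basis (evolution_product M) (\<lambda>i. axis i 1)"
    unfolding natural_basis_def eq
    by (auto simp: inj_def axis_eq_axis independent_cart_basis span_cart_basis
        evolution_product_axis)
  then show ?thesis
    using complex_bilinear_evolution_product by (auto simp: evolution_algebra_def)
qed

text \<open>
  The columns of \<open>h t\<close> form the new basis, and the rows of \<open>N t\<close> are the coordinates of their
  squares in that basis.
\<close>

lemma degeneration_evolution_productI:
  fixes M M' :: "complex^'n^'n" and g h N :: "real \<Rightarrow> complex^'n^'n"
  assumes cont: "continuous_on {0<..1} g"
    and inv: "\<And>t. t \<in> {0<..1} \<Longrightarrow> h t ** g t = mat 1"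
    and prod: "\<And>t. t \<in> {0<..1} \<Longrightarrow> \<forall>i j.
      evolution_product M (h t *v axis i 1) (h t *v axis j 1) = (if i = j then h t *v N t $ i else 0)"
    and lim: "(N \<longlongrightarrow> M') (at 0 within {0<..1})"
  shows "degeneration (evolution_product M) (evolution_product M')"
proof -
  have act: "invertible (g t) \<and> gl_action (g t) (evolution_product M) (axis i 1) (axis j 1)
      = evolution_product (N t) (axis i 1) (axis j 1)" if t: "t \<in> {0<..1}" for t i j
  proof -
    have gh: "g t ** h t = mat 1"
      using inv[OF t] matrix_left_right_inverse by blast
    have "matrix_inv (g t) = h t"
      using matrix_inv_unique[OF gh inv[OF t]] .
    moreover have "invertible (g t)"
      using gh inv[OF t] by (auto simp: invertible_def)
    ultimately show ?thesis
      by (simp add: gl_action_def prod[OF t, rule_format] evolution_product_axis matrix_vector_mul_assoc gh)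
  qed
  \<comment> \<open>Each structure constant of an evolution product is either constantly 0 or an
    entry of its matrix.\<close>
  have "((\<lambda>t. structure_constant (evolution_product (N t)) i j k)
      \<longlongrightarrow> structure_constant (evolution_product M') i j k) (at 0 within {0<..1})" for i j k
    using tendsto_vec_nth[OF tendsto_vec_nth[OF lim], of i k]
    by (auto simp: structure_constant_def evolution_product_axis)
  then have "((\<lambda>t. structure_constant (gl_action (g t) (evolution_product M)) i j k)
      \<longlongrightarrow> structure_constant (evolution_product M') i j k) (at 0 within {0<..1})" for i j k
    by (rule Lim_transform_eventually)
      (simp add: eventually_at_filter structure_constant_def act[THEN conjunct2])
  moreover have "natural_basis_change (g t) (evolution_product M)" if "t \<in> {0<..1}" for t
    using act[OF that] by (auto simp: natural_basis_change_def evolution_product_axis)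
  ultimately show ?thesis
    unfolding degeneration_def
    by (intro conjI exI[of _ g] ballI allI evolution_algebra_evolution_product cont)
qed

section \<open>The four algebras and their nilpotency\<close>

lemma mu3_apply:
  "mu3 1 x y = 0"
  "mu3 2 x y = vector [0, x $ 1 * y $ 1, 0]"
  "mu3 3 x y = vector [0, 0, x $ 1 * y $ 1 + x $ 2 * y $ 2]"
  "mu3 4 x y = vector [0, x $ 1 * y $ 1, x $ 2 * y $ 2]"
  by (simp_all add: mu3_def evolution_product_def sum_3 vec_eq_iff forall_3 axis_def)

lemma algebra_power_subsetI:
  assumes "vec.subspace S" "1 < k"
    and "\<And>i x y. 1 \<le> i \<Longrightarrow> i < k \<Longrightarrow> x \<in> algebra_power \<mu> i \<Longrightarrow> y \<in> algebra_power \<mu> (k - i) \<Longrightarrow> \<mu> x y \<in> S"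
  shows "algebra_power \<mu> k \<subseteq> S"
proof -
  have "(\<Union>i\<in>{1..<k}. {\<mu> x y | x y. x \<in> algebra_power \<mu> i \<and> y \<in> algebra_power \<mu> (k - i)}) \<subseteq> S"
    using assms(3) by fastforce
  then show ?thesis
    using vec.span_minimal[OF _ assms(1)] assms(2) by (subst algebra_power.simps) simp
qed

text \<open>The powers descend along the coordinate flag: the second lies in the span of e2 and e3,
  the third and fourth in the span of e3, and the fifth vanishes.\<close>

lemma nilpotent_algebra_3I:
  fixes \<mu> :: "3 product"
  assumes 1: "\<And>x y. \<mu> x y $ 1 = 0"
    and 2: "\<And>x y. x $ 1 = 0 \<or> y $ 1 = 0 \<Longrightarrow> \<mu> x y $ 2 = 0"
    and 3: "\<And>x y. x $ 1 = 0 \<Longrightarrow> y $ 1 = 0 \<Longrightarrow> x $ 2 = 0 \<or> y $ 2 = 0 \<Longrightarrow> \<mu> x y = 0"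
    and 4: "\<And>x y. x $ 1 = 0 \<and> x $ 2 = 0 \<or> y $ 1 = 0 \<and> y $ 2 = 0 \<Longrightarrow> \<mu> x y = 0"
  shows "nilpotent_algebra \<mu>"
proof -
  have sub: "vec.subspace {x::complex^3. x $ 1 = 0}"
    "vec.subspace {x::complex^3. x $ 1 = 0 \<and> x $ 2 = 0}" "vec.subspace {0::complex^3}"
    by (auto simp: vec.subspace_def)
  have p2: "algebra_power \<mu> 2 \<subseteq> {x. x $ 1 = 0}"
    by (rule algebra_power_subsetI[OF sub(1)]) (simp_all add: 1)
  have p3: "algebra_power \<mu> 3 \<subseteq> {x. x $ 1 = 0 \<and> x $ 2 = 0}"
  proof (rule algebra_power_subsetI[OF sub(2)])
    fix i x y
    assume "1 \<le> i" "i < (3::nat)" "x \<in> algebra_power \<mu> i" "y \<in> algebra_power \<mu> (3 - i)"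
    moreover from this have "i = 1 \<or> i = 2" by auto
    ultimately show "\<mu> x y \<in> {x. x $ 1 = 0 \<and> x $ 2 = 0}"
      using p2 by (auto simp: 1 intro!: 2)
  qed simp
  \<comment> \<open>The bound does not shrink from the third power to the fourth, since in
    \<open>mu3 4\<close> the product (e1 e1)(e1 e1) is e3.\<close>
  have p4: "algebra_power \<mu> 4 \<subseteq> {x. x $ 1 = 0 \<and> x $ 2 = 0}"
  proof (rule algebra_power_subsetI[OF sub(2)])
    fix i x y
    assume "1 \<le> i" "i < (4::nat)" "x \<in> algebra_power \<mu> i" "y \<in> algebra_power \<mu> (4 - i)"
    moreover from this have "i = 1 \<or> i = 2 \<or> i = 3" by auto
    ultimately show "\<mu> x y \<in> {x. x $ 1 = 0 \<and> x $ 2 = 0}"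
      using p2 p3 by (auto simp: 1 intro!: 2)
  qed simp
  have "algebra_power \<mu> 5 \<subseteq> {0}"
  proof (rule algebra_power_subsetI[OF sub(3)])
    fix i x y
    assume "1 \<le> i" "i < (5::nat)" "x \<in> algebra_power \<mu> i" "y \<in> algebra_power \<mu> (5 - i)"
    moreover from this have "i = 1 \<or> i = 2 \<or> i = 3 \<or> i = 4" by auto
    ultimately show "\<mu> x y \<in> {0}"
      using p2 p3 p4 by (auto intro!: 3 4)
  qed simp
  moreover have "0 \<in> algebra_power \<mu> 5"
    by (subst algebra_power.simps) (simp add: vec.span_zero)
  ultimately show ?thesis
    unfolding nilpotent_algebra_def by blast
qed

lemma mu3_in_nilpotent_evolution_algebras_3:
  assumes "m \<in> {1..4}"
  shows "mu3 m \<in> nilpotent_evolution_algebras_3"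
proof -
  have "m = 1 \<or> m = 2 \<or> m = 3 \<or> m = 4"
    using assms by auto
  then have "nilpotent_algebra (mu3 m)"
    \<comment> \<open>\<open>[simplified]\<close> rewrites \<open>mu3 1\<close> to
      \<open>mu3 (Suc 0)\<close>, the form that the goal takes under simplification.\<close>
    by (intro nilpotent_algebra_3I) (auto simp: mu3_apply[simplified] vec_eq_iff forall_3)
  moreover have "evolution_algebra (mu3 m)"
    by (simp add: mu3_def evolution_algebra_evolution_product)
  ultimately show ?thesis
    by (simp add: nilpotent_evolution_algebras_3_def)
qed

section \<open>The explicit degenerations\<close>

lemma tendsto_0_of_real: "((\<lambda>t. complex_of_real t) \<longlongrightarrow> 0) (at 0 within S)"
  by (rule tendsto_eq_intros refl | simp)+

lemma tendsto_vector_3: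
  fixes a b c :: "'a \<Rightarrow> 'b::{topological_space,zero}"
  assumes "(a \<longlongrightarrow> a') F" "(b \<longlongrightarrow> b') F" "(c \<longlongrightarrow> c') F"
  shows "((\<lambda>t. vector [a t, b t, c t] :: 'b^3) \<longlongrightarrow> vector [a', b', c']) F"
proof (rule vec_tendstoI)
  fix i :: 3
  show "((\<lambda>t. (vector [a t, b t, c t] :: 'b^3) $ i) \<longlongrightarrow> vector [a', b', c'] $ i) F"
    using exhaust_3[of i] assms by auto
qed

lemma continuous_on_vector_3:
  fixes a b c :: "'a::topological_space \<Rightarrow> 'b::{topological_space,zero}"
  assumes "continuous_on S a" "continuous_on S b" "continuous_on S c"
  shows "continuous_on S (\<lambda>t. vector [a t, b t, c t] :: 'b^3)"
  using assms unfolding continuous_on_def by (blast intro: tendsto_vector_3)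

lemmas matrix_3_simps = vec_eq_iff forall_3 matrix_matrix_mult_def matrix_vector_mult_def
  sum_3 mat_def axis_def evolution_product_def

text \<open>Take f1 = t e1, f2 = e2 - e3/t^2, f3 = e3. As e3 annihilates everything, the basis stays
  natural and f2^2 = f3. The shift of e2 is chosen so that f1^2 = t^2 e2 = t^2 f2 + f3, which tends
  to f3.\<close>

lemma degeneration_mu3_4_3: "degeneration (mu3 4) (mu3 3)"
proof -
  let ?g = "\<lambda>t. vector [vector [1 / of_real t, 0, 0], vector [0, 1, 0],
    vector [0, 1 / (of_real t)\<^sup>2, 1]] :: complex^3^3"
  let ?h = "\<lambda>t. vector [vector [of_real t, 0, 0], vector [0, 1, 0],
    vector [0, - 1 / (of_real t)\<^sup>2, 1]] :: complex^3^3"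
  let ?N = "\<lambda>t. vector [vector [0, (of_real t)\<^sup>2, 1], vector [0, 0, 1], 0] :: complex^3^3"
  have "continuous_on {0<..1} ?g"
    by (intro continuous_on_vector_3 continuous_intros) auto
  moreover have "(?N \<longlongrightarrow> vector [vector [0, 0, 1], vector [0, 0, 1], 0]) (at 0 within {0<..1})"
    by (intro tendsto_vector_3 tendsto_const) (use tendsto_power[OF tendsto_0_of_real, of 2] in simp)
  moreover have "vector [vector [0, 0, 1], vector [0, 0, 1], 0]
      = (vector [axis 3 1, axis 3 1, 0] :: complex^3^3)"
    by (simp add: matrix_3_simps)
  ultimately show ?thesis
    unfolding mu3_def
    by (simp, intro degeneration_evolution_productI[of ?g ?h _ ?N])
      (simp_all add: matrix_3_simps power2_eq_square)
qed

text \<open>Take f1 = e1, f2 = e3, f3 = t e2: then f1^2 = f2, and f3^2 = t^2 f2 dies in the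
  limit.\<close>

lemma degeneration_mu3_3_2: "degeneration (mu3 3) (mu3 2)"
proof -
  let ?g = "\<lambda>t. vector [vector [1, 0, 0], vector [0, 0, 1],
    vector [0, 1 / of_real t, 0]] :: complex^3^3"
  let ?h = "\<lambda>t. vector [vector [1, 0, 0], vector [0, 0, of_real t],
    vector [0, 1, 0]] :: complex^3^3"
  let ?N = "\<lambda>t. vector [vector [0, 1, 0], 0, vector [0, (of_real t)\<^sup>2, 0]] :: complex^3^3"
  have "continuous_on {0<..1} ?g"
    by (intro continuous_on_vector_3 continuous_intros) auto
  moreover have "(?N \<longlongrightarrow> vector [vector [0, 1, 0], 0, vector [0, 0, 0]]) (at 0 within {0<..1})"
    by (intro tendsto_vector_3 tendsto_const) (use tendsto_power[OF tendsto_0_of_real, of 2] in simp)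
  moreover have "vector [vector [0, 1, 0], 0, vector [0, 0, 0]]
      = (vector [axis 2 1, 0, 0] :: complex^3^3)"
    by (simp add: matrix_3_simps)
  ultimately show ?thesis
    unfolding mu3_def
    by (simp, intro degeneration_evolution_productI[of ?g ?h _ ?N])
      (simp_all add: matrix_3_simps power2_eq_square)
qed

text \<open>Scaling e1 by t turns the only nonzero square into t^2 e2.\<close>

lemma degeneration_mu3_2_1: "degeneration (mu3 2) (mu3 1)"
proof -
  let ?g = "\<lambda>t. vector [vector [1 / of_real t, 0, 0], vector [0, 1, 0],
    vector [0, 0, 1]] :: complex^3^3"
  let ?h = "\<lambda>t. vector [vector [of_real t, 0, 0], vector [0, 1, 0],
    vector [0, 0, 1]] :: complex^3^3"
  let ?N = "\<lambda>t. vector [vector [0, (of_real t)\<^sup>2, 0], 0, 0] :: complex^3^3"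
  have "continuous_on {0<..1} ?g"
    by (intro continuous_on_vector_3 continuous_intros) auto
  moreover have "(?N \<longlongrightarrow> vector [vector [0, 0, 0], 0, 0]) (at 0 within {0<..1})"
    by (intro tendsto_vector_3 tendsto_const) (use tendsto_power[OF tendsto_0_of_real, of 2] in simp)
  moreover have "vector [vector [0, 0, 0], 0, 0] = (vector [0, 0, 0] :: complex^3^3)"
    by (simp add: matrix_3_simps)
  ultimately show ?thesis
    unfolding mu3_def
    by (simp, intro degeneration_evolution_productI[of ?g ?h _ ?N])
      (simp_all add: matrix_3_simps power2_eq_square)
qed

text \<open>With f3 = e3/t and e1, e2 kept, e2^2 = t f3 tends to 0 while e1^2 = e2 stays.\<close>

lemma degeneration_mu3_4_2: "degeneration (mu3 4) (mu3 2)"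
proof -
  let ?g = "\<lambda>t. vector [vector [1, 0, 0], vector [0, 1, 0],
    vector [0, 0, of_real t]] :: complex^3^3"
  let ?h = "\<lambda>t. vector [vector [1, 0, 0], vector [0, 1, 0],
    vector [0, 0, 1 / of_real t]] :: complex^3^3"
  let ?N = "\<lambda>t. vector [vector [0, 1, 0], vector [0, 0, of_real t], 0] :: complex^3^3"
  have "continuous_on {0<..1} ?g"
    by (intro continuous_on_vector_3 continuous_intros)
  moreover have "(?N \<longlongrightarrow> vector [vector [0, 1, 0], vector [0, 0, 0], 0]) (at 0 within {0<..1})"
    by (intro tendsto_vector_3 tendsto_const tendsto_0_of_real)
  moreover have "vector [vector [0, 1, 0], vector [0, 0, 0], 0]
      = (vector [axis 2 1, 0, 0] :: complex^3^3)"
    by (simp add: matrix_3_simps)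
  ultimately show ?thesis
    unfolding mu3_def
    by (simp, intro degeneration_evolution_productI[of ?g ?h _ ?N])
      (simp_all add: matrix_3_simps)
qed

section \<open>The order of the four algebras under transitive degeneration\<close>

lemma transitive_degeneration_mu3:
  assumes "1 \<le> j" "j \<le> i" "i \<le> 4"
  shows "transitive_degeneration nilpotent_evolution_algebras_3 (mu3 i) (mu3 j)"
proof -
  have "degeneration (mu3 (Suc m)) (mu3 m)" if "1 \<le> m" "m < 4" for m
  proof -
    have "m = 1 \<or> m = 2 \<or> m = 3"
      using that by auto
    then show ?thesis
      using degeneration_mu3_4_3 degeneration_mu3_3_2 degeneration_mu3_2_1
      by (auto simp: numeral_eq_Suc)
  qed
  \<comment> \<open>The chain starts at \<open>i\<close> and descends one index per link, so its
    \<open>m\<close>-th member is \<open>mu3 (i - m)\<close> and it has \<open>i - j\<close>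
    links.\<close>
  from this[of "i - Suc m" for m]
  have "degeneration (mu3 (i - m)) (mu3 (i - Suc m))" if "m < i - j" for m
    using that assms by (simp add: Suc_diff_Suc)
  then have "transitive_degeneration nilpotent_evolution_algebras_3 (mu3 (i - 0)) (mu3 (i - (i - j)))"
    by (intro transitive_degenerationI[where c = "\<lambda>m. mu3 (i - m)"]
        mu3_in_nilpotent_evolution_algebras_3) (use assms in auto)
  then show ?thesis
    using assms by simp
qed

lemma not_transitive_degeneration_mu3:
  assumes "1 \<le> i" "i < j" "j \<le> 4"
  shows "\<not> transitive_degeneration F (mu3 i) (mu3 j)"
proof
  assume td: "transitive_degeneration F (mu3 i) (mu3 j)"
  \<comment> \<open>One case per invariant: the zero product, the rank-one identity, and (xy)z =
    0.\<close>
  consider "i = 1" "j = 2 \<or> j = 3 \<or> j = 4" | "i = 2" "j = 3" | "i = 2 \<or> i = 3" "j = 4"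
    using assms by force
  then show False
  proof cases
    case 1
    have "\<forall>x y. mu3 j x y = 0"
      using td by (rule transitive_degeneration_induct)
        (use 1 in \<open>auto simp: mu3_apply[simplified] intro: degeneration_zero_product\<close>)
    then have "mu3 j (axis 1 1) (axis 1 1) = 0"
      by blast
    then show False
      using 1(2) by (auto simp: mu3_apply vec_eq_iff forall_3 axis_def)
  next
    case 2
    have "rank_one_product (mu3 2)"
      by (simp add: rank_one_product_def mu3_apply forall_3)
    then have "rank_one_product (mu3 j)"
      using transitive_degeneration_induct[OF td] degeneration_rank_one_product 2(1) by blast
    \<comment> \<open>In \<open>mu3 3\<close> both squares equal e3 but e1 e2 = 0, so the identity
      would read 1 = 0.\<close>
    then have "mu3 j (axis 1 1) (axis 1 1) $ 3 * mu3 j (axis 2 1) (axis 2 1) $ 3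
        = mu3 j (axis 1 1) (axis 2 1) $ 3 * mu3 j (axis 1 1) (axis 2 1) $ 3"
      unfolding rank_one_product_def by blast
    then show False
      using 2 by (simp add: mu3_apply axis_def)
  next
    case 3
    have "two_step_product (mu3 i)"
      using 3(1) by (auto simp: two_step_product_def mu3_apply vec_eq_iff forall_3)
    then have "two_step_product (mu3 j)"
      using transitive_degeneration_induct[OF td] degeneration_two_step_product by blast
    \<comment> \<open>In \<open>mu3 4\<close> this product is e2 e2 = e3.\<close>
    then have "mu3 j (mu3 j (axis 1 1) (axis 1 1)) (axis 2 1) = 0"
      unfolding two_step_product_def by blast
    then show False
      using 3(2) by (simp add: mu3_apply vec_eq_iff forall_3 axis_def)
  qed
qed

theorem theorem5p12:
  "degeneration (mu3 4) (mu3 3) \<and> degeneration (mu3 3) (mu3 2) \<and> degeneration (mu3 2) (mu3 1) \<and>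
   (\<forall>i\<in>{1..4}. \<forall>j\<in>{1..4}. i \<noteq> j \<longrightarrow>
      (transitive_degeneration nilpotent_evolution_algebras_3 (mu3 i) (mu3 j) \<longleftrightarrow> i > j)) \<and>
   degeneration (mu3 4) (mu3 2)"
  using degeneration_mu3_4_3 degeneration_mu3_3_2 degeneration_mu3_2_1 degeneration_mu3_4_2
    transitive_degeneration_mu3 not_transitive_degeneration_mu3
  by (metis atLeastAtMost_iff linorder_neqE_nat less_imp_le)

end
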